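(* Let $\mathfrak g$ be a Lie algebra with an almost pseudo-Hermitian structure. Then the $\mathfrak{cu}(p,q)$-Nikolayevsky derivation of $\mathfrak g$ has rational eigenvalues.
   Context: Lie algebras are real and finite-dimensional. An almost pseudo-Hermitian structure on $\mathfrak g$ is a pair $(g,J)$, where $g$ is a nondegenerate symmetric bilinear form of signature $(2p,2q)$ and $J\in\mathrm{End}(\mathfrak g)$ satisfies $J^2=-\mathrm{Id}$ and $g(JX,JY)=g(X,Y)$ (no integrability is required). Given such a structure, $\mathfrak u(p,q)\subset\mathfrak{gl}(\mathfrak g)$ denotes the Lie algebra of endomorphisms that are skew-symmetric with respect to $g$ and commute with $J$, and $\mathfrak{cu}(p,q)=\mathfrak u(p,q)\oplus\mathrm{Span}\{\mathrm{Id}\}\subset\mathfrak{gl}(\mathfrak g)$. The $\mathfrak{cu}(p,q)$-Nikolayevsky derivation of $\mathfrak g$ is a semisimple (i.e. diagonalizable over $\mathbb C$) derivation $N\in\mathfrak{cu}(p,q)\cap\mathrm{Der}\,\mathfrak g$ such that $\mathrm{tr}(N\psi)=\mathrm{tr}\,\psi$ for all $\psi\in\mathfrak{cu}(p,q)\cap\mathrm{Der}\,\mathfrak g$. Such an $N$ exists and is unique up to automorphisms. *)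

theory Defs
  imports "HOL-Analysis.Analysis"
begin

section \<open>Lie algebras with an almost pseudo-Hermitian structure\<close>

text \<open>The underlying vector space is a whole type of class real_vector with a finite basis.
  The zero space is not excluded.\<close>

definition is_basis :: "'a::real_vector set \<Rightarrow> bool" where
  "is_basis B \<longleftrightarrow> finite B \<and> independent B \<and> span B = UNIV"

locale lie_algebra =
  fixes br :: "'a::real_vector \<Rightarrow> 'a \<Rightarrow> 'a"
  assumes finite_dim: "\<exists>B :: 'a set. is_basis B"
    and bilinear_br: "bilinear br"
    and alternating: "br x x = 0"
    and jacobi: "br x (br y z) + br y (br z x) + br z (br x y) = 0"

definition Der :: "('a::real_vector \<Rightarrow> 'a \<Rightarrow> 'a) \<Rightarrow> ('a \<Rightarrow> 'a) set" where
  "Der br = {D. linear D \<and> (\<forall>x y. D (br x y) = br (D x) y + br x (D y))}"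

text \<open>The form has signature \<open>(r, s)\<close>: some orthogonal basis consists of \<open>r\<close> vectors of
  square \<open>1\<close> and \<open>s\<close> vectors of square \<open>-1\<close>. By Sylvester's law of inertia \<open>(r, s)\<close> is unique.\<close>

definition has_signature :: "('a::real_vector \<Rightarrow> 'a \<Rightarrow> real) \<Rightarrow> nat \<Rightarrow> nat \<Rightarrow> bool" where
  "has_signature g r s \<longleftrightarrow>
     (\<exists>P M. P \<inter> M = {} \<and> is_basis (P \<union> M) \<and> card P = r \<and> card M = s \<and>
        (\<forall>b\<in>P \<union> M. \<forall>c\<in>P \<union> M. b \<noteq> c \<longrightarrow> g b c = 0) \<and>
        (\<forall>b\<in>P. g b b = 1) \<and> (\<forall>b\<in>M. g b b = - 1))"

locale almost_pseudo_hermitian =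
  fixes g :: "'a::real_vector \<Rightarrow> 'a \<Rightarrow> real"
    and J :: "'a \<Rightarrow> 'a"
    and p q :: nat
  assumes bilinear_g: "bilinear g"
    and symmetric_g: "g x y = g y x"
    and nondegenerate_g: "(\<And>y. g x y = 0) \<Longrightarrow> x = 0"
    and signature_g: "has_signature g (2 * p) (2 * q)"
    and linear_J: "linear J"
    and J_square: "J (J x) = - x"
    and J_isometry: "g (J x) (J y) = g x y"

definition u_alg :: "('a::real_vector \<Rightarrow> 'a \<Rightarrow> real) \<Rightarrow> ('a \<Rightarrow> 'a) \<Rightarrow> ('a \<Rightarrow> 'a) set" where
  "u_alg g J = {A. linear A \<and> (\<forall>x y. g (A x) y = - g x (A y)) \<and> (\<forall>x. A (J x) = J (A x))}"

definition cu_alg :: "('a::real_vector \<Rightarrow> 'a \<Rightarrow> real) \<Rightarrow> ('a \<Rightarrow> 'a) \<Rightarrow> ('a \<Rightarrow> 'a) set" where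
  "cu_alg g J = {\<lambda>x. A x + c *\<^sub>R x | A c. A \<in> u_alg g J}"


section \<open>Trace of an endomorphism\<close>

text \<open>The trace is computed in a chosen basis; lemma \<open>tr_eq\<close> shows that the choice is
  irrelevant.\<close>

definition tr :: "('a::real_vector \<Rightarrow> 'a) \<Rightarrow> real" where
  "tr f = (let B = (SOME B. is_basis B) in \<Sum>b\<in>B. representation B (f b) b)"

lemma sum_representation:
  assumes "is_basis B"
  shows "(\<Sum>b\<in>B. representation B x b *\<^sub>R b) = x"
  using assms unfolding is_basis_def
  by (intro real_vector.sum_representation_eq) auto

lemma representation_linear:
  assumes B: "is_basis B" and f: "linear f" and C: "is_basis C"
  shows "representation B (f x) b = (\<Sum>c\<in>C. representation C x c * representation B (f c) b)"
proof -
  have ind: "independent B" and sp: "\<And>v. v \<in> span B"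
    using B by (auto simp: is_basis_def)
  have "f x = f (\<Sum>c\<in>C. representation C x c *\<^sub>R c)"
    by (simp add: sum_representation[OF C])
  also have "\<dots> = (\<Sum>c\<in>C. representation C x c *\<^sub>R f c)"
    using f by (simp add: linear_sum linear_scale)
  finally show ?thesis
    using ind sp by (simp add: real_vector.representation_sum real_vector.representation_scale)
qed

lemma tr_eq:
  assumes B: "is_basis B" and f: "linear f"
  shows "tr f = (\<Sum>b\<in>B. representation B (f b) b)"
proof -
  define C :: "'a set" where "C = (SOME B. is_basis B)"
  have C: "is_basis C"
    unfolding C_def using B by (rule someI)
  have id: "linear (\<lambda>x::'a. x)"
    by (simp add: linear_iff)
  have "tr f = (\<Sum>c\<in>C. representation C (f c) c)"
    by (simp add: tr_def C_def Let_def)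
  also have "\<dots> = (\<Sum>c\<in>C. \<Sum>b\<in>B. representation B (f c) b * representation C b c)"
    by (intro sum.cong refl) (rule representation_linear[OF C id B])
  also have "\<dots> = (\<Sum>b\<in>B. \<Sum>c\<in>C. representation C b c * representation B (f c) b)"
    by (subst sum.swap) (simp add: mult.commute)
  also have "\<dots> = (\<Sum>b\<in>B. representation B (f b) b)"
    by (intro sum.cong refl) (rule representation_linear[OF B f C, symmetric])
  finally show ?thesis .
qed


section \<open>Complexification, eigenvalues and semisimplicity\<close>

text \<open>The pair \<open>(x, y)\<close> stands for \<open>x + i y\<close> in the complexification, and the complex-linear
  extension of \<open>f\<close> is \<open>map_prod f f\<close>.\<close>

definition cscale :: "complex \<Rightarrow> 'a::real_vector \<times> 'a \<Rightarrow> 'a \<times> 'a" where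
  "cscale z v = (Re z *\<^sub>R fst v - Im z *\<^sub>R snd v, Re z *\<^sub>R snd v + Im z *\<^sub>R fst v)"

interpretation cplx: vector_space "cscale :: complex \<Rightarrow> 'a::real_vector \<times> 'a \<Rightarrow> 'a \<times> 'a"
  by unfold_locales (auto simp: cscale_def algebra_simps)

definition eigenvector :: "('a::real_vector \<Rightarrow> 'a) \<Rightarrow> complex \<Rightarrow> 'a \<times> 'a \<Rightarrow> bool" where
  "eigenvector f z v \<longleftrightarrow> v \<noteq> 0 \<and> map_prod f f v = cscale z v"

definition eigenvalue :: "('a::real_vector \<Rightarrow> 'a) \<Rightarrow> complex \<Rightarrow> bool" where
  "eigenvalue f z \<longleftrightarrow> (\<exists>v. eigenvector f z v)"

definition semisimple :: "('a::real_vector \<Rightarrow> 'a) \<Rightarrow> bool" where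
  "semisimple f \<longleftrightarrow> linear f \<and>
     (\<exists>E. cplx.independent E \<and> cplx.span E = UNIV \<and> (\<forall>v\<in>E. \<exists>z. eigenvector f z v))"


section \<open>Nikolayevsky derivations\<close>

definition cu_nikolayevsky ::
  "('a::real_vector \<Rightarrow> 'a \<Rightarrow> 'a) \<Rightarrow> ('a \<Rightarrow> 'a \<Rightarrow> real) \<Rightarrow> ('a \<Rightarrow> 'a) \<Rightarrow> ('a \<Rightarrow> 'a) \<Rightarrow> bool" where
  "cu_nikolayevsky br g J N \<longleftrightarrow>
     semisimple N \<and> N \<in> cu_alg g J \<inter> Der br \<and>
     (\<forall>\<psi>\<in>cu_alg g J \<inter> Der br. tr (N \<circ> \<psi>) = tr \<psi>)"

end

theory Submission
  imports Defs
begin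

text \<open>
  Let \<open>\<lambda>\<^sub>v\<close> be the eigenvalues of \<open>N\<close> (\<open>\<alpha> v\<close> in the code) along an eigenbasis \<open>E\<close> of the
  complexification, and let
  \<open>\<phi>\<close> be an additive map from the complex numbers to themselves. The operator \<open>\<phi>(N)\<close>, acting by
  \<open>\<phi>(\<lambda>\<^sub>v)\<close> on \<open>v\<close>, inherits from \<open>N\<close> every relation that is additive in the eigenvalues: the
  bracket of eigenvectors for \<open>\<lambda>\<close> and \<open>\<lambda>'\<close> is zero or has eigenvalue \<open>\<lambda> + \<lambda>'\<close>, so \<open>\<phi>(N)\<close> is a
  derivation; the form vanishes on such a pair unless \<open>\<lambda> + \<lambda>'\<close> is the similarity factor \<open>c\<close>
  of \<open>N\<close>, so \<open>\<phi>(N)\<close> rescales the form infinitesimally by \<open>\<phi>(c)\<close>; and \<open>J\<close> preserves the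
  eigenspaces, so it commutes with \<open>\<phi>(N)\<close>. The first two facts are the single lemma
  \<open>diag_leibniz\<close>. Hence the real and imaginary parts of \<open>\<phi>(N)\<close> are derivations in the conformal
  unitary algebra (\<open>re_im_diag_Der\<close>, \<open>re_im_diag_cu_alg\<close>), and the trace condition on \<open>N\<close>,
  applied to both, gives the complex identity \<open>\<Sum> \<lambda>\<^sub>v \<phi>(\<lambda>\<^sub>v) = \<Sum> \<phi>(\<lambda>\<^sub>v)\<close> (\<open>trace_identity\<close>).

  Suppose now that \<open>\<phi>\<close> is rational-linear with rational values and \<open>\<phi>(1) = 0\<close>. Applying \<open>\<phi>\<close> to
  the identity yields \<open>\<Sum> \<phi>(\<lambda>\<^sub>v)\<^sup>2 = \<phi>(1) \<Sum> \<phi>(\<lambda>\<^sub>v) = 0\<close>, so \<open>\<phi>\<close> kills every eigenvalue. An irrational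
  eigenvalue is linearly independent of \<open>1\<close> over the rationals and therefore admits such a \<open>\<phi>\<close>
  that does not kill it (\<open>exists_rat_functional\<close>), a contradiction.
\<close>

section \<open>Rational-valued functionals on the complex numbers\<close>

text \<open>An irrational number and \<open>1\<close> are linearly independent over the rationals, so their values
  can be prescribed and extended over a rational (Hamel) basis of the complex numbers.\<close>

lemma exists_rat_functional:
  fixes z :: complex
  assumes "z \<notin> \<rat>"
  obtains \<phi> :: "complex \<Rightarrow> rat"
  where "\<And>x y. \<phi> (x + y) = \<phi> x + \<phi> y"
    and "\<And>r x. \<phi> (of_rat r * x) = r * \<phi> x"
    and "\<phi> 1 = 0" and "\<phi> z = 1"
proof -
  interpret vector_space_pair "\<lambda>r (x::complex). of_rat r * x" "(*) :: rat \<Rightarrow> rat \<Rightarrow> rat"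
    by unfold_locales (auto simp: algebra_simps of_rat_add of_rat_mult)
  have "z \<notin> vs1.span {1}"
    using assms by (auto simp: vs1.span_singleton Rats_def)
  then have "vs1.independent {z, 1}"
    using vs1.independent_insert[of z "{1}"] by (auto simp: vs1.independent_insert)
  then obtain \<phi> where lin: "Vector_Spaces.linear (\<lambda>r (x::complex). of_rat r * x) (*) \<phi>"
    and val: "\<forall>x\<in>{z, 1}. \<phi> x = (if x = z then 1 else 0)"
    using linear_independent_extend[of "{z, 1}" "\<lambda>x. if x = z then 1 else 0"] by blast
  have "z \<noteq> 1" using assms by auto
  with val show thesis
    by (intro that[of \<phi>]) (auto simp: linear_add[OF lin] linear_scale[OF lin])
qed

section \<open>Complexified maps\<close>

interpretation cplx: vector_space_pair
  "cscale :: complex \<Rightarrow> 'a::real_vector \<times> 'a \<Rightarrow> 'a \<times> 'a"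
  "cscale :: complex \<Rightarrow> 'b::real_vector \<times> 'b \<Rightarrow> 'b \<times> 'b"
  by unfold_locales

abbreviation clinear :: "('a::real_vector \<times> 'a \<Rightarrow> 'b::real_vector \<times> 'b) \<Rightarrow> bool" where
  "clinear \<equiv> Vector_Spaces.linear cscale cscale"

lemma clinearI:
  assumes "\<And>x y. f (x + y) = f x + f y" "\<And>z x. f (cscale z x) = cscale z (f x)"
  shows "clinear f"
  using assms by (simp add: cplx.vector_space_axioms
      Vector_Spaces.linear_iff del: split_paired_All)

lemma clinear_plus: "clinear f \<Longrightarrow> f (x + y) = f x + f y"
  and clinear_scale: "clinear f \<Longrightarrow> f (cscale z x) = cscale z (f x)"
  by (simp_all add: Vector_Spaces.linear_iff del: split_paired_All)

lemma clinear_cscale: "clinear (cscale z)"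
  by (intro clinearI) (simp_all add: cplx.scale_right_distrib mult.commute)

lemma clinear_map_prod: "linear f \<Longrightarrow> clinear (map_prod f f)"
  by (intro clinearI) (auto simp: cscale_def linear_add linear_scale linear_diff)

text \<open>The complex-bilinear extension of a real-bilinear map. A form is treated on the same footing
  as a bracket: its values then lie in \<open>real \<times> real\<close>, the complexification of the real line.\<close>

definition cbilin :: "('a::real_vector \<Rightarrow> 'a \<Rightarrow> 'b::real_vector) \<Rightarrow> 'a \<times> 'a \<Rightarrow> 'a \<times> 'a \<Rightarrow> 'b \<times> 'b" where
  "cbilin h u w = (h (fst u) (fst w) - h (snd u) (snd w), h (fst u) (snd w) + h (snd u) (fst w))"

lemma clinear_cbilin_left: "bilinear h \<Longrightarrow> clinear (\<lambda>u. cbilin h u w)"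
  by (intro clinearI) (auto simp: cbilin_def cscale_def bilinear_ladd bilinear_lmul bilinear_lsub
      algebra_simps)

lemma clinear_cbilin_right: "bilinear h \<Longrightarrow> clinear (cbilin h u)"
  by (intro clinearI) (auto simp: cbilin_def cscale_def bilinear_radd bilinear_rmul bilinear_rsub
      algebra_simps)

lemma clinear_add: "clinear f \<Longrightarrow> clinear k \<Longrightarrow> clinear (\<lambda>x. f x + k x)"
  by (intro clinearI) (simp_all add: clinear_plus clinear_scale cplx.scale_right_distrib)

lemma clinear_compose: "clinear f \<Longrightarrow> clinear k \<Longrightarrow> clinear (\<lambda>x. f (k x))"
  by (intro clinearI) (simp_all add: clinear_plus clinear_scale)

lemma cscale_of_real: "cscale (of_real r) u = r *\<^sub>R u"
  by (simp add: cscale_def prod_eq_iff)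

section \<open>Functional calculus in a complex eigenbasis\<close>

locale eigenbasis =
  fixes N :: "'a::real_vector \<Rightarrow> 'a" and E :: "('a \<times> 'a) set" and \<alpha> :: "'a \<times> 'a \<Rightarrow> complex"
  assumes finite_E: "finite E"
    and independent_E: "cplx.independent E"
    and span_E: "cplx.span E = UNIV"
    and linear_N: "linear N"
    and eigen_E: "v \<in> E \<Longrightarrow> map_prod N N v = cscale (\<alpha> v) v"
begin

abbreviation coord :: "'a \<times> 'a \<Rightarrow> 'a \<times> 'a \<Rightarrow> complex" where
  "coord \<equiv> cplx.representation E"

text \<open>The functional calculus is \<open>diag (\<phi> \<circ> \<alpha>)\<close>. General diagonal operators are allowed so that
  the product with \<open>N\<close> is again of this form.\<close>

definition diag :: "('a \<times> 'a \<Rightarrow> complex) \<Rightarrow> 'a \<times> 'a \<Rightarrow> 'a \<times> 'a" where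
  "diag \<mu> u = (\<Sum>v\<in>E. cscale (coord u v * \<mu> v) v)"

lemma in_span: "u \<in> cplx.span E"
  by (simp add: span_E)

lemma coord_sum: "(\<Sum>v\<in>E. cscale (coord u v) v) = u"
  by (rule cplx.sum_representation_eq[OF independent_E in_span finite_E]) simp

lemma coord_add: "coord (u + w) v = coord u v + coord w v"
  by (simp add: cplx.representation_add[OF independent_E in_span in_span])

lemma coord_cscale: "coord (cscale z u) v = z * coord u v"
  by (simp add: cplx.representation_scale[OF independent_E in_span])

lemma coord_clinear_sum: 
  "coord (\<Sum>b\<in>B. cscale (c b) (w b)) v = (\<Sum>b\<in>B. c b * coord (w b) v)"
  by (simp add: cplx.representation_sum[OF independent_E in_span] coord_cscale)

lemma clinear_diag: "clinear (diag \<mu>)"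
  by (intro clinearI) (simp_all add: diag_def coord_add coord_cscale cplx.scale_left_distrib
      distrib_right sum.distrib cplx.scale_sum_right mult.assoc)

lemma diag_basis: "v \<in> E \<Longrightarrow> diag \<mu> v = cscale (\<mu> v) v"
  using finite_E
  by (simp add: diag_def cplx.representation_basis[OF independent_E] if_distrib [of "\<lambda>c. c * _"]
      if_distrib [of "\<lambda>c. cscale c _"] cong: if_cong)

lemma clinear_eqI:
  assumes "clinear f" "clinear k" "\<And>v. v \<in> E \<Longrightarrow> f v = k v"
  shows "f u = k u"
  using cplx.linear_eq_on[OF assms(1,2) in_span assms(3)] .

lemma map_prod_N: "map_prod N N u = diag \<alpha> u"
  by (rule clinear_eqI[OF clinear_map_prod[OF linear_N] clinear_diag])
     (simp add: eigen_E diag_basis)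

lemma coord_diag: "v \<in> E \<Longrightarrow> coord (diag \<mu> u) v = \<mu> v * coord u v"
  using finite_E
  by (simp add: diag_def coord_clinear_sum cplx.representation_basis[OF independent_E]
      if_distrib [of "\<lambda>c. c * _"] mult.commute cong: if_cong)

text \<open>Applying \<open>N\<close> multiplies the coordinate at \<open>v\<close> by \<open>\<alpha> v\<close> on the one hand and by \<open>z\<close> on the
  other. So an arbitrary eigenvector involves only basis vectors with the same eigenvalue.\<close>

lemma coord_eigen:
  assumes "map_prod N N u = cscale z u" "v \<in> E" "coord u v \<noteq> 0"
  shows "\<alpha> v = z"
  using assms coord_diag[of v \<alpha> u] by (simp add: map_prod_N coord_cscale)

lemma eigenvalue_in_basis:
  assumes "eigenvalue N z"
  obtains v where "v \<in> E" "\<alpha> v = z"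
proof -
  obtain u where u: "u \<noteq> 0" "map_prod N N u = cscale z u"
    using assms by (auto simp: eigenvalue_def eigenvector_def)
  have "\<exists>v\<in>E. coord u v \<noteq> 0"
    using coord_sum[of u] u(1) by (metis (no_types, lifting) cplx.scale_zero_left sum.neutral)
  with u(2) that coord_eigen show thesis by blast
qed

text \<open>The operator \<open>\<phi>(N)\<close> is thereby determined on all eigenvectors of \<open>N\<close>, independently of \<open>E\<close>;
  this makes it applicable to brackets of basis vectors and to their images under \<open>J\<close>.\<close>

lemma diag_eigen:
  assumes "map_prod N N u = cscale z u"
  shows "diag (\<phi> \<circ> \<alpha>) u = cscale (\<phi> z) u"
proof -
  have "diag (\<phi> \<circ> \<alpha>) u = (\<Sum>v\<in>E. cscale (\<phi> z) (cscale (coord u v) v))"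
    unfolding diag_def using coord_eigen[OF assms]
    by (intro sum.cong refl) (auto simp: mult.commute)
  then show ?thesis
    by (simp add: cplx.scale_sum_right[symmetric] coord_sum del: cplx.scale_scale)
qed

lemma diag_commutes:
  assumes L: "linear L" and NL: "\<And>x. N (L x) = L (N x)"
  shows "diag (\<phi> \<circ> \<alpha>) (map_prod L L u) = map_prod L L (diag (\<phi> \<circ> \<alpha>) u)"
proof (rule clinear_eqI[where u = u])
  note cL = clinear_map_prod[OF L]
  show "clinear (\<lambda>u. diag (\<phi> \<circ> \<alpha>) (map_prod L L u))" "clinear (\<lambda>u. map_prod L L (diag (\<phi> \<circ> \<alpha>) u))"
    by (rule clinear_compose[OF clinear_diag cL] clinear_compose[OF cL clinear_diag])+
  fix v assume v: "v \<in> E"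
  have "map_prod N N (map_prod L L v) = map_prod L L (map_prod N N v)"
    by (simp add: prod_eq_iff NL)
  also have "\<dots> = cscale (\<alpha> v) (map_prod L L v)"
    using cL v by (simp add: eigen_E clinear_plus clinear_scale)
  finally show "diag (\<phi> \<circ> \<alpha>) (map_prod L L v) = map_prod L L (diag (\<phi> \<circ> \<alpha>) v)"
    using cL v by (simp add: diag_eigen diag_basis clinear_plus clinear_scale)
qed

text \<open>By bilinearity only basis vectors \<open>v\<close>, \<open>v'\<close> matter. The Leibniz rule for \<open>N\<close> and \<open>M\<close> says that
  \<open>h(v, v')\<close> satisfies the eigenvalue equation of \<open>M\<close> for the sum of the two eigenvalues, and the
  additive \<open>\<phi>\<close> splits that sum again. The operator \<open>M\<close> on the target and its transform \<open>F\<close> are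
  kept abstract to cover brackets (\<open>M = N\<close>, \<open>F = \<phi>(N)\<close>) as well as forms (\<open>M\<close> and \<open>F\<close>
  multiplications by \<open>c\<close> and \<open>\<phi>(c)\<close>).\<close>

lemma diag_leibniz:
  fixes h :: "'a \<Rightarrow> 'a \<Rightarrow> 'b::real_vector"
  assumes h: "bilinear h"
    and M: "\<And>x y. M (h x y) = h (N x) y + h x (N y)" "linear M"
    and F: "clinear F" "\<And>u z. map_prod M M u = cscale z u \<Longrightarrow> F u = cscale (\<phi> z) u"
    and \<phi>: "\<And>x y. \<phi> (x + y) = \<phi> x + \<phi> y"
  shows "F (cbilin h u w) = cbilin h (diag (\<phi> \<circ> \<alpha>) u) w + cbilin h u (diag (\<phi> \<circ> \<alpha>) w)"
proof (rule clinear_eqI[where u = u])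
  note left = clinear_cbilin_left[OF h] and right = clinear_cbilin_right[OF h]
  show "clinear (\<lambda>u. F (cbilin h u w))"
    by (rule clinear_compose[OF F(1) left])
  show "clinear (\<lambda>u. cbilin h (diag (\<phi> \<circ> \<alpha>) u) w + cbilin h u (diag (\<phi> \<circ> \<alpha>) w))"
    by (rule clinear_add[OF clinear_compose[OF left clinear_diag] left])
  fix v assume v: "v \<in> E"
  show "F (cbilin h v w) = cbilin h (diag (\<phi> \<circ> \<alpha>) v) w + cbilin h v (diag (\<phi> \<circ> \<alpha>) w)"
  proof (rule clinear_eqI[where u = w])
    show "clinear (\<lambda>w. F (cbilin h v w))"
      by (rule clinear_compose[OF F(1) right])
    show "clinear (\<lambda>w. cbilin h (diag (\<phi> \<circ> \<alpha>) v) w + cbilin h v (diag (\<phi> \<circ> \<alpha>) w))"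
      by (rule clinear_add[OF right clinear_compose[OF right clinear_diag]])
    fix v' assume v': "v' \<in> E"
    have pull: "cbilin h (cscale a v) v' = cscale a (cbilin h v v')"
      "cbilin h v (cscale a v') = cscale a (cbilin h v v')" for a
      using clinear_scale[OF left] clinear_scale[OF right] by simp_all
    have "map_prod M M (cbilin h v v') = cbilin h (map_prod N N v) v' + cbilin h v (map_prod N N v')"
      using M(2) by (simp add: cbilin_def prod_eq_iff M(1) linear_add linear_diff)
    also have "\<dots> = cscale (\<alpha> v + \<alpha> v') (cbilin h v v')"
      using v v' by (simp add: eigen_E pull cplx.scale_left_distrib)
    finally have "F (cbilin h v v') = cscale (\<phi> (\<alpha> v + \<alpha> v')) (cbilin h v v')"
      by (rule F(2))
    then show "F (cbilin h v v') = cbilin h (diag (\<phi> \<circ> \<alpha>) v) v' + cbilin h v (diag (\<phi> \<circ> \<alpha>) v')"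
      using v v' by (simp add: diag_basis pull \<phi> cplx.scale_left_distrib)
  qed
qed

section \<open>Real and imaginary parts\<close>

text \<open>A complex-linear operator \<open>T\<close> is \<open>a + i b\<close> for unique real operators \<open>a\<close> and \<open>b\<close>, which are
  read off from its values on real vectors.\<close>

definition re_diag :: "('a \<times> 'a \<Rightarrow> complex) \<Rightarrow> 'a \<Rightarrow> 'a" where
  "re_diag \<mu> x = fst (diag \<mu> (x, 0))"

definition im_diag :: "('a \<times> 'a \<Rightarrow> complex) \<Rightarrow> 'a \<Rightarrow> 'a" where
  "im_diag \<mu> x = snd (diag \<mu> (x, 0))"

lemma diag_real: "diag \<mu> (x, 0) = (re_diag \<mu> x, im_diag \<mu> x)"
  by (simp add: re_diag_def im_diag_def)

lemma linear_re_im_diag: "linear (re_diag \<mu>)" "linear (im_diag \<mu>)"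
proof -
  have "diag \<mu> (x + y, 0) = diag \<mu> (x, 0) + diag \<mu> (y, 0)" for x y
    using clinear_plus[OF clinear_diag, of \<mu> "(x, 0)" "(y, 0)"] by simp
  moreover have "diag \<mu> (r *\<^sub>R x, 0) = r *\<^sub>R diag \<mu> (x, 0)" for r x
    using clinear_scale[OF clinear_diag, of \<mu> "of_real r" "(x, 0)"] by (simp add: cscale_of_real)
  ultimately show "linear (re_diag \<mu>)" "linear (im_diag \<mu>)"
    by (simp_all add: linear_iff re_diag_def im_diag_def)
qed

text \<open>Both sides are the complex trace of \<open>diag \<mu>\<close>: on the left in the basis \<open>(b, 0)\<close> of the
  complexification, on the right in the basis \<open>E\<close>.\<close>

lemma trace_diag:
  assumes B: "is_basis (B :: 'a set)"
  shows "Complex (tr (re_diag \<mu>)) (tr (im_diag \<mu>)) = (\<Sum>v\<in>E. \<mu> v)"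
proof -
  \<comment> \<open>the complex coordinates with respect to the basis of all \<open>(b, 0)\<close>\<close>
  define R where "R u b = Complex (representation B (fst u) b) (representation B (snd u) b)"
    for u :: "'a \<times> 'a" and b
  have ind: "independent B" and sp: "\<And>v. v \<in> span B"
    using B by (auto simp: is_basis_def)
  have R_add: "R (u + w) b = R u b + R w b" for u w b
    by (simp add: R_def real_vector.representation_add[OF ind sp sp] complex_eq_iff)
  have R_scale: "R (cscale z u) b = z * R u b" for z u b
    by (simp add: R_def cscale_def real_vector.representation_add[OF ind sp sp]
        real_vector.representation_diff[OF ind sp sp]
        real_vector.representation_scale[OF ind sp] complex_eq_iff)
  have R_sum: "R (\<Sum>v\<in>A. f v) b = (\<Sum>v\<in>A. R (f v) b)" for A b and f :: "'a \<times> 'a \<Rightarrow> 'a \<times> 'a"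
  proof -
    have "R 0 b = 0" using R_add[of 0 0 b] by simp
    then show ?thesis by (induction A rule: infinite_finite_induct) (auto simp: R_add)
  qed
  have expand: "(\<Sum>b\<in>B. cscale (R u b) (b, 0)) = u" for u
    using sum_representation[OF B, of "fst u"] sum_representation[OF B, of "snd u"]
    by (simp add: cscale_def R_def prod_eq_iff fst_sum snd_sum)
  have "Complex (tr (re_diag \<mu>)) (tr (im_diag \<mu>)) = (\<Sum>b\<in>B. R (diag \<mu> (b, 0)) b)"
    by (simp add: tr_eq[OF B linear_re_im_diag(1)] tr_eq[OF B linear_re_im_diag(2)] R_def
        diag_real complex_eq_iff)
  also have "\<dots> = (\<Sum>b\<in>B. \<Sum>v\<in>E. \<mu> v * (R v b * coord (b, 0) v))"
    by (simp add: diag_def R_sum R_scale mult_ac)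
  also have "\<dots> = (\<Sum>v\<in>E. \<mu> v * (\<Sum>b\<in>B. R v b * coord (b, 0) v))"
    by (subst sum.swap) (simp add: sum_distrib_left)
  also have "\<dots> = (\<Sum>v\<in>E. \<mu> v * coord v v)"
    by (simp add: expand flip: coord_clinear_sum)
  also have "\<dots> = (\<Sum>v\<in>E. \<mu> v)"
    by (simp add: cplx.representation_basis[OF independent_E])
  finally show ?thesis .
qed

lemma N_re_im_diag:
  "N \<circ> re_diag \<mu> = re_diag (\<lambda>v. \<alpha> v * \<mu> v)" "N \<circ> im_diag \<mu> = im_diag (\<lambda>v. \<alpha> v * \<mu> v)"
proof -
  have "map_prod N N (diag \<mu> u) = diag (\<lambda>v. \<alpha> v * \<mu> v) u" for u
  proof (rule clinear_eqI[where u = u])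
    show "clinear (\<lambda>u. map_prod N N (diag \<mu> u))"
      by (rule clinear_compose[OF clinear_map_prod[OF linear_N] clinear_diag])
  qed (use clinear_map_prod[OF linear_N] in \<open>auto simp: clinear_diag diag_basis eigen_E clinear_plus clinear_scale mult.commute\<close>)
  then have "map_prod N N (diag \<mu> (x, 0)) = diag (\<lambda>v. \<alpha> v * \<mu> v) (x, 0)" for x .
  then show "N \<circ> re_diag \<mu> = re_diag (\<lambda>v. \<alpha> v * \<mu> v)" "N \<circ> im_diag \<mu> = im_diag (\<lambda>v. \<alpha> v * \<mu> v)"
    by (auto simp: fun_eq_iff diag_real)
qed

text \<open>On real vectors the real and imaginary components of the Leibniz rule for \<open>\<phi>(N)\<close> decouple.\<close>

lemma re_im_diag_Der:
  assumes br: "bilinear br" and N: "N \<in> Der br"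
    and \<phi>: "\<And>x y. \<phi> (x + y) = \<phi> x + \<phi> y"
  shows "re_diag (\<phi> \<circ> \<alpha>) \<in> Der br" "im_diag (\<phi> \<circ> \<alpha>) \<in> Der br"
proof -
  have "diag (\<phi> \<circ> \<alpha>) (cbilin br u w) =
      cbilin br (diag (\<phi> \<circ> \<alpha>) u) w + cbilin br u (diag (\<phi> \<circ> \<alpha>) w)" for u w
    using N by (intro diag_leibniz[OF br _ linear_N clinear_diag _ \<phi>] diag_eigen) (auto simp: Der_def)
  from this[of "(_, 0)" "(_, 0)"]
  show "re_diag (\<phi> \<circ> \<alpha>) \<in> Der br" "im_diag (\<phi> \<circ> \<alpha>) \<in> Der br"
    by (simp_all add: Der_def linear_re_im_diag cbilin_def diag_real bilinear_lzero[OF br]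
        bilinear_rzero[OF br])
qed

end

section \<open>Membership in the conformal unitary algebra\<close>

text \<open>The next two lemmas describe the conformal unitary algebra by the factor by which an operator
  rescales the form infinitesimally; that factor is twice the coefficient of the identity.\<close>

lemma cu_algI:
  assumes g: "bilinear g" and A: "linear A" and J: "linear J" "\<And>x. A (J x) = J (A x)"
    and sim: "\<And>x y. g (A x) y + g x (A y) = c * g x y"
  shows "A \<in> cu_alg g J"
proof -
  let ?A = "\<lambda>x. A x - (c/2) *\<^sub>R x"
  have "g (?A x) y = - g x (?A y)" for x y
    using sim[of x y] 
    by (simp add: bilinear_lsub[OF g] bilinear_rsub[OF g] bilinear_lmul[OF g] bilinear_rmul[OF g])
  moreover have "linear ?A"
    using A by (simp add: linear_iff algebra_simps)
  ultimately have "?A \<in> u_alg g J"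
    using J by (simp add: u_alg_def linear_diff linear_scale)
  moreover have "A = (\<lambda>x. ?A x + (c/2) *\<^sub>R x)"
    by simp
  ultimately show ?thesis
    unfolding cu_alg_def mem_Collect_eq by (intro exI[of _ ?A] exI[of _ "c/2"] conjI)
qed

lemma cu_algE:
  assumes g: "bilinear g" and J: "linear J" and A: "A \<in> cu_alg g J"
  obtains c where "\<And>x y. g (A x) y + g x (A y) = c * g x y" "\<And>x. A (J x) = J (A x)"
proof -
  obtain S c where S: "S \<in> u_alg g J" "A = (\<lambda>x. S x + c *\<^sub>R x)"
    using A by (auto simp: cu_alg_def)
  have "g (A x) y + g x (A y) = 2 * c * g x y" for x y
    using S by (simp add: u_alg_def bilinear_ladd[OF g] bilinear_radd[OF g] bilinear_lmul[OF g] bilinear_rmul[OF g])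
  moreover have "A (J x) = J (A x)" for x
    using S J by (simp add: u_alg_def linear_add linear_scale)
  ultimately show thesis by (rule that)
qed

context eigenbasis
begin

text \<open>The form is a bilinear map for which \<open>N\<close> satisfies a Leibniz rule with multiplication by
  \<open>c\<close> on the target, where \<open>c\<close> is the similarity factor of \<open>N\<close>. So \<open>\<phi>(N)\<close> has the complex
  similarity factor \<open>\<phi>(c)\<close>, whose real and imaginary parts are the factors of the two real
  operators.\<close>

lemma re_im_diag_cu_alg:
  assumes g: "bilinear g" and J: "linear J" and N: "N \<in> cu_alg g J"
    and \<phi>: "\<And>x y. \<phi> (x + y) = \<phi> x + \<phi> y"
  shows "re_diag (\<phi> \<circ> \<alpha>) \<in> cu_alg g J" "im_diag (\<phi> \<circ> \<alpha>) \<in> cu_alg g J"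
proof -
  obtain c where c: "\<And>x y. g (N x) y + g x (N y) = c * g x y" and NJ: "\<And>x. N (J x) = J (N x)"
    using cu_algE[OF g J N] by blast
  \<comment> \<open>the only eigenvalue of multiplication by \<open>c\<close> is \<open>c\<close>, the case \<open>u = 0\<close> being trivial\<close>
  have eig: "cscale (\<phi> (of_real c)) u = cscale (\<phi> z) u"
    if "map_prod ((*) c) ((*) c) u = cscale z u" for u :: "real \<times> real" and z
  proof -
    have "cscale (of_real c) u = cscale z u"
      using that by (simp add: cscale_of_real prod_eq_iff)
    then show ?thesis
      by (auto simp: cplx.scale_cancel_right)
  qed
  have "cscale (\<phi> (of_real c)) (cbilin g u w) =
      cbilin g (diag (\<phi> \<circ> \<alpha>) u) w + cbilin g u (diag (\<phi> \<circ> \<alpha>) w)" for u w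
    by (rule diag_leibniz[OF g _ _ clinear_cscale eig \<phi>, where M = "(*) c"])
       (simp_all add: c linear_iff distrib_left)
  from this[of "(_, 0)" "(_, 0)"]
  have sim: "g (re_diag (\<phi> \<circ> \<alpha>) x) y + g x (re_diag (\<phi> \<circ> \<alpha>) y) = Re (\<phi> (of_real c)) * g x y"
    "g (im_diag (\<phi> \<circ> \<alpha>) x) y + g x (im_diag (\<phi> \<circ> \<alpha>) y) = Im (\<phi> (of_real c)) * g x y" for x y
    by (simp_all add: cbilin_def diag_real cscale_def bilinear_lzero[OF g] bilinear_rzero[OF g])
  have "diag (\<phi> \<circ> \<alpha>) (J x, 0) = map_prod J J (diag (\<phi> \<circ> \<alpha>) (x, 0))" for x
    using diag_commutes[OF J NJ, of \<phi> "(x, 0)"] J by (simp add: linear_0)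
  then have comm: "re_diag (\<phi> \<circ> \<alpha>) (J x) = J (re_diag (\<phi> \<circ> \<alpha>) x)"
    "im_diag (\<phi> \<circ> \<alpha>) (J x) = J (im_diag (\<phi> \<circ> \<alpha>) x)" for x
    by (simp_all add: diag_real)
  show "re_diag (\<phi> \<circ> \<alpha>) \<in> cu_alg g J"
    using g linear_re_im_diag(1) J comm(1) sim(1) by (rule cu_algI)
  show "im_diag (\<phi> \<circ> \<alpha>) \<in> cu_alg g J"
    using g linear_re_im_diag(2) J comm(2) sim(2) by (rule cu_algI)
qed

text \<open>The real and imaginary parts of this identity are the trace condition for the real and
  imaginary parts of \<open>\<phi>(N)\<close>.\<close>

lemma trace_identity:
  assumes "is_basis (B :: 'a set)"
    and br: "bilinear br" and g: "bilinear g" and J: "linear J"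
    and N: "cu_nikolayevsky br g J N"
    and \<phi>: "\<And>x y. \<phi> (x + y) = \<phi> x + \<phi> y"
  shows "(\<Sum>v\<in>E. \<alpha> v * \<phi> (\<alpha> v)) = (\<Sum>v\<in>E. \<phi> (\<alpha> v))"
proof -
  have NC: "N \<in> cu_alg g J" and ND: "N \<in> Der br"
    and tr: "\<And>\<psi>. \<psi> \<in> cu_alg g J \<inter> Der br \<Longrightarrow> tr (N \<circ> \<psi>) = tr \<psi>"
    using N by (auto simp: cu_nikolayevsky_def)
  note mem = IntI[OF re_im_diag_cu_alg(1)[where \<phi> = \<phi>, OF g J NC \<phi>] re_im_diag_Der(1)[where \<phi> = \<phi>, OF br ND \<phi>]]
    IntI[OF re_im_diag_cu_alg(2)[where \<phi> = \<phi>, OF g J NC \<phi>] re_im_diag_Der(2)[where \<phi> = \<phi>, OF br ND \<phi>]]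
  show ?thesis
    using tr[OF mem(1)] tr[OF mem(2)] trace_diag[OF assms(1), of "\<phi> \<circ> \<alpha>"]
      trace_diag[OF assms(1), of "\<lambda>v. \<alpha> v * (\<phi> \<circ> \<alpha>) v"]
    by (simp add: N_re_im_diag)
qed

end

section \<open>Rationality of the eigenvalues\<close>

text \<open>Finiteness of the eigenbasis comes from comparison with the spanning set of all \<open>(b, 0)\<close>.\<close>

lemma semisimple_eigenbasis:
  assumes B: "is_basis (B :: 'a::real_vector set)" and N: "semisimple (N :: 'a \<Rightarrow> 'a)"
  obtains E \<alpha> where "eigenbasis N E \<alpha>"
proof -
  obtain E where E: "linear N" "cplx.independent E" "cplx.span E = UNIV"
    "\<forall>v\<in>E. \<exists>z. eigenvector N z v"
    using N by (auto simp: semisimple_def)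
  then obtain \<alpha> where \<alpha>: "\<forall>v\<in>E. eigenvector N (\<alpha> v) v"
    by metis
  let ?B = "(\<lambda>b. (b, 0::'a)) ` B"
  have "u \<in> cplx.span ?B" for u
  proof -
    have "u = (\<Sum>b\<in>B. cscale (Complex (representation B (fst u) b) (representation B (snd u) b)) (b, 0))"
      using sum_representation[OF B, of "fst u"] sum_representation[OF B, of "snd u"]
      by (simp add: cscale_def prod_eq_iff fst_sum snd_sum)
    also have "\<dots> \<in> cplx.span ?B"
      by (intro cplx.span_sum cplx.span_scale cplx.span_base) auto
    finally show ?thesis .
  qed
  then have "E \<subseteq> cplx.span ?B"
    by blast
  moreover have "finite ?B"
    using B by (simp add: is_basis_def)
  ultimately have "finite E"
    using cplx.independent_span_bound[OF _ E(2)] by blast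
  with E \<alpha> have "eigenbasis N E \<alpha>"
    by (simp add: eigenbasis_def eigenvector_def)
  then show thesis by (rule that)
qed

theorem proposition2p8:
  fixes br :: "'a::real_vector \<Rightarrow> 'a \<Rightarrow> 'a"
    and g :: "'a \<Rightarrow> 'a \<Rightarrow> real"
    and J N :: "'a \<Rightarrow> 'a"
    and p q :: nat
  assumes "lie_algebra br"
    and "almost_pseudo_hermitian g J p q"
    and "cu_nikolayevsky br g J N"
  shows "\<forall>z. eigenvalue N z \<longrightarrow> z \<in> \<rat>"
proof (intro allI impI, rule ccontr)
  fix z assume "eigenvalue N z" "z \<notin> \<rat>"
  obtain B :: "'a set" where B: "is_basis B"
    using lie_algebra.finite_dim[OF assms(1)] by blast
  have "semisimple N"
    using assms(3) by (simp add: cu_nikolayevsky_def)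
  then obtain E \<alpha> where "eigenbasis N E \<alpha>"
    using semisimple_eigenbasis[OF B] by blast
  then interpret eigenbasis N E \<alpha> .
  obtain \<phi> :: "complex \<Rightarrow> rat" where add: "\<And>x y. \<phi> (x + y) = \<phi> x + \<phi> y"
    and scale: "\<And>r x. \<phi> (of_rat r * x) = r * \<phi> x"
    and \<phi>1: "\<phi> 1 = 0" and \<phi>z: "\<phi> z = 1"
    using exists_rat_functional[OF \<open>z \<notin> \<rat>\<close>] by blast
  have sum: "\<phi> (\<Sum>v\<in>E. f v) = (\<Sum>v\<in>E. \<phi> (f v))" for f
    using Modules.additive.sum[of \<phi> f E] add by (simp add: Modules.additive_def)
  have "(\<Sum>v\<in>E. \<alpha> v * of_rat (\<phi> (\<alpha> v))) = (\<Sum>v\<in>E. of_rat (\<phi> (\<alpha> v)))"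
    using trace_identity[OF B lie_algebra.bilinear_br[OF assms(1)]
        almost_pseudo_hermitian.bilinear_g[OF assms(2)]
        almost_pseudo_hermitian.linear_J[OF assms(2)] assms(3), of "\<lambda>x. of_rat (\<phi> x)"]
    by (simp add: add of_rat_add)
  \<comment> \<open>the values of \<open>\<phi>\<close> are rational scalars, so an outer \<open>\<phi>\<close> passes them\<close>
  then have "\<phi> (\<Sum>v\<in>E. of_rat (\<phi> (\<alpha> v)) * \<alpha> v) = \<phi> (\<Sum>v\<in>E. of_rat (\<phi> (\<alpha> v)) * 1)"
    by (simp add: mult.commute)
  then have "(\<Sum>v\<in>E. \<phi> (\<alpha> v) * \<phi> (\<alpha> v)) = 0"
    unfolding sum scale \<phi>1 by simp
  then have "\<forall>v\<in>E. \<phi> (\<alpha> v) = 0"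
    using finite_E by (simp add: sum_nonneg_eq_0_iff)
  moreover obtain v where "v \<in> E" "\<alpha> v = z"
    using eigenvalue_in_basis[OF \<open>eigenvalue N z\<close>] .
  ultimately show False
    using \<phi>z by auto
qed

end
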